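(* Let $X$ be an irreducible continuous-time Markov process on a finite set $\mathcal{X}$ with kernel $p$, reversible with respect to the probability measure $\mu$, with spectral gap $\gamma$. For all $\kappa,\lambda>0$ and any $\mathcal{R}\subset\mathcal{X}$ such that the restricted processes $X_{\mathcal{R}}$ and $X_{\mathcal{X}\setminus\mathcal{R}}$ are both irreducible Markov processes, writing $\phi_\kappa^\lambda=C_\kappa^\lambda(\mathcal{R},\mathcal{X}\setminus\mathcal{R})/(\mu(\mathcal{R})\mu(\mathcal{X}\setminus\mathcal{R}))$, one has (1) $$\frac1\gamma\ge\frac{1}{\phi_\kappa^\lambda}\left\{1-\frac{C_\kappa(\mathcal{R},\mathcal{X}\setminus\mathcal{R})}{\kappa\mu(\mathcal{R})}-\frac{C^\lambda(\mathcal{R},\mathcal{X}\setminus\mathcal{R})}{\lambda\mu(\mathcal{X}\setminus\mathcal{R})}\right\}^2;$$ (2) $$\frac1\gamma\le\frac{1}{\phi_\kappa^\lambda}\left\{1+\max\left(\frac{\kappa+\phi_\kappa^\lambda}{\gamma_{\mathcal{R}}},\frac{\lambda+\phi_\kappa^\lambda}{\gamma_{\mathcal{X}\setminus\mathcal{R}}}\right)\right\}.$$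
   Context: $X$ has generator $\mathcal{L}f(x)=\sum_{y\in\mathcal{X}}p(x,y)(f(y)-f(x))$ with $p\ge0$, $\sum_yp(x,y)=1$; $\mu(x)p(x,y)=\mu(y)p(y,x)=:c(x,y)$. $\mathcal{D}(f)=\frac12\sum_{x,y\in\mathcal{X}}c(x,y)(f(x)-f(y))^2$ and $\gamma=\min_{\mathrm{Var}_\mu(f)\ne0}\mathcal{D}(f)/\mathrm{Var}_\mu(f)$. For $A=\mathcal{R}$ or $A=\mathcal{X}\setminus\mathcal{R}$, the restricted process $X_A$ on $A$ has kernel $p_A(x,y)=p(x,y)$ for $x\ne y$ in $A$, $p_A(x,x)=p(x,x)+\sum_{y\notin A}p(x,y)$; it is reversible with respect to $\mu_A=\mu(\cdot\mid A)$, and its spectral gap is $\gamma_A=\min_{\mathrm{Var}_{\mu_A}(f)\neq0}\mathcal{D}_A(f)/\mathrm{Var}_{\mu_A}(f)$, $\mathcal{D}_A(f)=\frac12\sum_{x,y\in A}\mu_A(x)p_A(x,y)(f(x)-f(y))^2$. With minima over $f:\mathcal{X}\to\mathbb{R}$, $$C_\kappa^\lambda(\mathcal{R},\mathcal{X}\setminus\mathcal{R})=\min_{f}\Big\{\mathcal{D}(f)+\kappa\sum_{a\in\mathcal{R}}\mu(a)(f(a)-1)^2+\lambda\sum_{b\in\mathcal{X}\setminus\mathcal{R}}\mu(b)f(b)^2\Big\},$$ and, for the cases where $\lambda$ or $\kappa$ is infinite (the infinite index being dropped), $$C_\kappa(\mathcal{R},\mathcal{X}\setminus\mathcal{R})=\min_{f|_{\mathcal{X}\setminus\mathcal{R}}=0}\Big\{\mathcal{D}(f)+\kappa\sum_{a\in\mathcal{R}}\mu(a)(f(a)-1)^2\Big\},\quad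 C^\lambda(\mathcal{R},\mathcal{X}\setminus\mathcal{R})=\min_{f|_{\mathcal{R}}=1}\Big\{\mathcal{D}(f)+\lambda\sum_{b\in\mathcal{X}\setminus\mathcal{R}}\mu(b)f(b)^2\Big\}.$$
   Formalization: Part (1) is proved only when the bracket {1 − C_κ/(κμ(R)) − C^λ/(λμ(X∖R))} is nonnegative; for all κ,λ>0 it is false (two states, p(a,b)=p(b,a)=1, μ uniform, κ=λ=1/10: right side ≈7.03 > 1/γ=1/2). Part (2) is unrestricted. *)

theory Defs
  imports "HOL-Probability.Probability"
begin

text \<open>
  A continuous-time Markov process on a finite set \<open>X\<close> with generator
  \<open>L f x = (\<Sum>y\<in>X. p x y * (f y - f x))\<close> is represented by its kernel \<open>p\<close>.
  Kernels and test functions are total functions on the ambient type, but only their values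
  on the state space are ever used.
\<close>

definition markov_kernel :: "'a set \<Rightarrow> ('a \<Rightarrow> 'a \<Rightarrow> real) \<Rightarrow> bool" where
  "markov_kernel X p \<longleftrightarrow>
     (\<forall>x\<in>X. \<forall>y\<in>X. 0 \<le> p x y) \<and> (\<forall>x\<in>X. (\<Sum>y\<in>X. p x y) = 1)"

text \<open>A state space is nonempty; a one-point chain is irreducible.\<close>

definition irreducible_kernel :: "'a set \<Rightarrow> ('a \<Rightarrow> 'a \<Rightarrow> real) \<Rightarrow> bool" where
  "irreducible_kernel X p \<longleftrightarrow>
     X \<noteq> {} \<and> (\<forall>x\<in>X. \<forall>y\<in>X. (x, y) \<in> {(u, v). u \<in> X \<and> v \<in> X \<and> 0 < p u v}\<^sup>*)"

definition conductance :: "'a pmf \<Rightarrow> ('a \<Rightarrow> 'a \<Rightarrow> real) \<Rightarrow> 'a \<Rightarrow> 'a \<Rightarrow> real" where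
  "conductance \<mu> p x y = pmf \<mu> x * p x y"

definition reversible_kernel :: "'a set \<Rightarrow> 'a pmf \<Rightarrow> ('a \<Rightarrow> 'a \<Rightarrow> real) \<Rightarrow> bool" where
  "reversible_kernel X \<mu> p \<longleftrightarrow> (\<forall>x\<in>X. \<forall>y\<in>X. conductance \<mu> p x y = conductance \<mu> p y x)"

definition dirichlet_form :: "'a set \<Rightarrow> 'a pmf \<Rightarrow> ('a \<Rightarrow> 'a \<Rightarrow> real) \<Rightarrow> ('a \<Rightarrow> real) \<Rightarrow> real" where
  "dirichlet_form X \<mu> p f = 1 / 2 * (\<Sum>x\<in>X. \<Sum>y\<in>X. conductance \<mu> p x y * (f x - f y)\<^sup>2)"

text \<open>
  Extended-real valued: on a one-point state space every variance vanishes and the gap is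
  \<open>\<infinity>\<close>, the infimum of the empty set.  Here and in the capacities below, infima stand for
  minima; on a finite state space they are attained (apart from the empty case just mentioned).
\<close>

definition spectral_gap :: "'a set \<Rightarrow> 'a pmf \<Rightarrow> ('a \<Rightarrow> 'a \<Rightarrow> real) \<Rightarrow> ereal" where
  "spectral_gap X \<mu> p =
     (INF f\<in>{f. measure_pmf.variance \<mu> f \<noteq> 0}.
        ereal (dirichlet_form X \<mu> p f / measure_pmf.variance \<mu> f))"

definition restricted_kernel :: "'a set \<Rightarrow> ('a \<Rightarrow> 'a \<Rightarrow> real) \<Rightarrow> 'a set \<Rightarrow> 'a \<Rightarrow> 'a \<Rightarrow> real" where
  "restricted_kernel X p A x y = (if x = y then p x x + (\<Sum>z\<in>X - A. p x z) else p x y)"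

definition restricted_gap :: "'a set \<Rightarrow> 'a pmf \<Rightarrow> ('a \<Rightarrow> 'a \<Rightarrow> real) \<Rightarrow> 'a set \<Rightarrow> ereal" where
  "restricted_gap X \<mu> p A = spectral_gap A (cond_pmf \<mu> A) (restricted_kernel X p A)"

text \<open>
  The capacities \<open>C\<^sub>\<kappa>\<^sup>\<lambda>(A,B)\<close>, \<open>C\<^sub>\<kappa>(A,B)\<close> and \<open>C\<^sup>\<lambda>(A,B)\<close>, to be used with \<open>B = X - A\<close>;
  the parameter \<open>\<lambda>\<close> is written \<open>l\<close>.
\<close>

definition soft_cap ::
    "'a set \<Rightarrow> 'a pmf \<Rightarrow> ('a \<Rightarrow> 'a \<Rightarrow> real) \<Rightarrow> real \<Rightarrow> real \<Rightarrow> 'a set \<Rightarrow> 'a set \<Rightarrow> real" where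
  "soft_cap X \<mu> p \<kappa> l A B =
     (INF f. dirichlet_form X \<mu> p f
        + \<kappa> * (\<Sum>a\<in>A. pmf \<mu> a * (f a - 1)\<^sup>2) + l * (\<Sum>b\<in>B. pmf \<mu> b * (f b)\<^sup>2))"

definition soft_cap_left ::
    "'a set \<Rightarrow> 'a pmf \<Rightarrow> ('a \<Rightarrow> 'a \<Rightarrow> real) \<Rightarrow> real \<Rightarrow> 'a set \<Rightarrow> 'a set \<Rightarrow> real" where
  "soft_cap_left X \<mu> p \<kappa> A B =
     (INF f\<in>{f. \<forall>b\<in>B. f b = 0}.
        dirichlet_form X \<mu> p f + \<kappa> * (\<Sum>a\<in>A. pmf \<mu> a * (f a - 1)\<^sup>2))"

definition soft_cap_right ::
    "'a set \<Rightarrow> 'a pmf \<Rightarrow> ('a \<Rightarrow> 'a \<Rightarrow> real) \<Rightarrow> real \<Rightarrow> 'a set \<Rightarrow> 'a set \<Rightarrow> real" where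
  "soft_cap_right X \<mu> p l A B =
     (INF f\<in>{f. \<forall>a\<in>A. f a = 1}.
        dirichlet_form X \<mu> p f + l * (\<Sum>b\<in>B. pmf \<mu> b * (f b)\<^sup>2))"

definition transition_rate ::
    "'a set \<Rightarrow> 'a pmf \<Rightarrow> ('a \<Rightarrow> 'a \<Rightarrow> real) \<Rightarrow> real \<Rightarrow> real \<Rightarrow> 'a set \<Rightarrow> real" where
  "transition_rate X \<mu> p \<kappa> l R =
     soft_cap X \<mu> p \<kappa> l R (X - R) / (measure_pmf.prob \<mu> R * measure_pmf.prob \<mu> (X - R))"

end

theory Submission
  imports Defs
begin

text \<open>
  Write \<open>a = \<mu>(R)\<close>, \<open>b = \<mu>(X - R)\<close>, let \<open>m\<close> and \<open>n\<close> be the conditional means of \<open>f\<close> on \<open>R\<close> and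
  \<open>X - R\<close>, and let \<open>C\<close> be the soft capacity.  No equilibrium potential is needed; everything
  comes from test functions and from
  \<open>Var f = a Var\<^sub>R f + b Var\<^sub>X\<^sub>-\<^sub>R f + a b (m - n)\<^sup>2\<close>.

  Upper bound on \<open>1 / \<gamma>\<close>: testing \<open>C\<close> with \<open>(f - n) / (m - n)\<close> gives
  \<open>C (m - n)\<^sup>2 \<le> D f + \<kappa> a Var\<^sub>R f + l b Var\<^sub>X\<^sub>-\<^sub>R f\<close>, and the two variances are
  controlled by the restricted gaps.

  Lower bound: bounding the energy of \<open>f\<close> below by the energy of three springs in series, with
  elongations \<open>1 - m\<close>, \<open>m - n\<close>, \<open>n\<close>, yields \<open>1 / C \<le> 1 / (\<gamma> a b) + 1 / (\<kappa> a) + 1 / (l b)\<close>.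
  Since \<open>C\<close> is at most each of the one-sided capacities, the bracket \<open>\<beta>\<close> of the theorem satisfies
  \<open>\<beta> \<le> \<phi> / \<gamma>\<close>, and \<open>\<beta>\<^sup>2 \<le> \<beta>\<close> when \<open>0 \<le> \<beta> \<le> 1\<close>.
\<close>

section \<open>Cauchy-Schwarz for three springs in series\<close>

text \<open>Read \<open>a\<close>, \<open>b\<close>, \<open>c\<close> as compliances and
  \<open>A\<close>, \<open>B\<close>, \<open>C\<close> as energies: compliances add in series. After
  expanding the square, each cross term is handled by the arithmetic-geometric mean inequality.
  Division is avoided so that a compliance may be zero.\<close>

lemma square_sum3_le_mult:
  fixes x y z :: real
  assumes x: "x\<^sup>2 \<le> a * A" and y: "y\<^sup>2 \<le> b * B" and z: "z\<^sup>2 \<le> c * C"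
    and nonneg: "0 \<le> a" "0 \<le> b" "0 \<le> c" "0 \<le> A" "0 \<le> B" "0 \<le> C"
  shows "(x + y + z)\<^sup>2 \<le> (a + b + c) * (A + B + C)"
proof -
  have cross: "2 * (u * v) \<le> s * T + t * S"
    if "u\<^sup>2 \<le> s * S" "v\<^sup>2 \<le> t * T" "0 \<le> s" "0 \<le> t" "0 \<le> S" "0 \<le> T" for u v s t S T :: real
  proof (rule power2_le_imp_le)
    have "(2 * (u * v))\<^sup>2 = 4 * (u\<^sup>2 * v\<^sup>2)" by (simp add: power_mult_distrib)
    also have "\<dots> \<le> 4 * ((s * S) * (t * T))"
      using that by (intro mult_left_mono mult_mono) auto
    also have "\<dots> \<le> (s * T + t * S)\<^sup>2"
      using zero_le_power2[of "s * T - t * S"] by (simp add: power2_eq_square algebra_simps)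
    finally show "(2 * (u * v))\<^sup>2 \<le> (s * T + t * S)\<^sup>2" .
    show "0 \<le> s * T + t * S" using that by simp
  qed
  have "(x + y + z)\<^sup>2 = x\<^sup>2 + y\<^sup>2 + z\<^sup>2 + 2 * (x * y) + 2 * (x * z) + 2 * (y * z)"
    by (simp add: power2_eq_square algebra_simps)
  also have "\<dots> \<le> a * A + b * B + c * C + (a * B + b * A) + (a * C + c * A) + (b * C + c * B)"
    using cross[OF x y] cross[OF x z] cross[OF y z] x y z nonneg by linarith
  finally show ?thesis by (simp add: algebra_simps)
qed

section \<open>Finitely supported laws\<close>

lemma variance_pmf_finite:
  fixes f :: "'a \<Rightarrow> real"
  assumes "finite X" "set_pmf \<mu> \<subseteq> X"
  shows "measure_pmf.variance \<mu> f = (\<Sum>x\<in>X. pmf \<mu> x * (f x)\<^sup>2) - (\<Sum>x\<in>X. pmf \<mu> x * f x)\<^sup>2"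
proof -
  have fin: "finite (set_pmf \<mu>)" using assms finite_subset by blast
  have E: "measure_pmf.expectation \<mu> g = (\<Sum>x\<in>X. pmf \<mu> x * g x)" for g :: "'a \<Rightarrow> real"
    using integral_measure_pmf[OF assms(1), of \<mu> g] assms(2) by auto
  show ?thesis
    by (subst measure_pmf.variance_eq)
      (simp_all add: E integrable_measure_pmf_finite[OF fin])
qed

lemma sum_pmf_eq_prob:
  assumes "finite A"
  shows "(\<Sum>x\<in>A. pmf \<mu> x) = measure_pmf.prob \<mu> A"
  using assms by (simp add: measure_measure_pmf_finite)

text \<open>Detailed balance carries positive mass along every edge of positive rate, and
  irreducibility then spreads it over all of \<open>X\<close>. This makes the conditional laws on
  \<open>R\<close> and \<open>X - R\<close> well defined.\<close>

lemma set_pmf_eq_if_irreducible: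
  assumes "irreducible_kernel X p" "reversible_kernel X \<mu> p" "set_pmf \<mu> \<subseteq> X"
  shows "set_pmf \<mu> = X"
proof -
  obtain x where x: "x \<in> set_pmf \<mu>" using set_pmf_not_empty[of \<mu>] by auto
  have "y \<in> set_pmf \<mu>" if "(x, y) \<in> {(u, v). u \<in> X \<and> v \<in> X \<and> 0 < p u v}\<^sup>*" for y
    using that
  proof induction
    case base
    then show ?case using x by simp
  next
    case (step y z)
    then have "0 < pmf \<mu> y * p y z" by (simp add: pmf_positive)
    moreover have "pmf \<mu> y * p y z = pmf \<mu> z * p z y"
      using step assms(2) by (auto simp: reversible_kernel_def conductance_def)
    ultimately show ?case by (auto simp: set_pmf_iff)
  qed
  then show ?thesis using assms x unfolding irreducible_kernel_def by blast
qed

section \<open>Elementary properties of the Dirichlet form\<close>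

lemma conductance_nonneg:
  assumes "\<forall>x\<in>X. \<forall>y\<in>X. 0 \<le> p x y" "x \<in> X" "y \<in> X"
  shows "0 \<le> conductance \<mu> p x y * (r :: real)\<^sup>2"
  using assms by (simp add: conductance_def)

lemma dirichlet_form_nonneg:
  assumes "\<forall>x\<in>X. \<forall>y\<in>X. 0 \<le> p x y"
  shows "0 \<le> dirichlet_form X \<mu> p f"
  unfolding dirichlet_form_def
  using conductance_nonneg[OF assms] by (simp add: sum_nonneg)

lemma dirichlet_form_edge:
  assumes "finite X" and nonneg: "\<forall>x\<in>X. \<forall>y\<in>X. 0 \<le> p x y" and "x \<in> X" "y \<in> X"
  shows "conductance \<mu> p x y * (f x - f y)\<^sup>2 \<le> 2 * dirichlet_form X \<mu> p f"
proof -
  have "conductance \<mu> p x y * (f x - f y)\<^sup>2 \<le> (\<Sum>y\<in>X. conductance \<mu> p x y * (f x - f y)\<^sup>2)"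
    using conductance_nonneg[OF nonneg] assms by (intro member_le_sum) auto
  also have "\<dots> \<le> (\<Sum>x\<in>X. \<Sum>y\<in>X. conductance \<mu> p x y * (f x - f y)\<^sup>2)"
    using conductance_nonneg[OF nonneg] assms
    by (intro member_le_sum[where f = "\<lambda>x. \<Sum>y\<in>X. conductance \<mu> p x y * (f x - f y)\<^sup>2"])
      (auto intro!: sum_nonneg)
  finally show ?thesis by (simp add: dirichlet_form_def)
qed

lemma dirichlet_form_affine:
  "dirichlet_form X \<mu> p (\<lambda>x. (f x - s) / t) = dirichlet_form X \<mu> p f / t\<^sup>2"
proof -
  have "((f x - s) / t - (f y - s) / t)\<^sup>2 = (f x - f y)\<^sup>2 / t\<^sup>2" for x y
    by (simp add: power_divide flip: diff_divide_distrib)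
  then show ?thesis by (simp add: dirichlet_form_def sum_divide_distrib mult.commute)
qed

section \<open>Poincare inequalities and the spectral gap\<close>

text \<open>Induction along a path of positive rates. The point is the order of quantifiers:
  \<open>K\<close> depends on the endpoints but not on \<open>f\<close>.\<close>

lemma poincare_path:
  assumes "finite X" and nonneg: "\<forall>x\<in>X. \<forall>y\<in>X. 0 \<le> p x y" and "X \<subseteq> set_pmf \<mu>"
    and "(x, y) \<in> {(u, v). u \<in> X \<and> v \<in> X \<and> 0 < p u v}\<^sup>*"
  shows "\<exists>K\<ge>0. \<forall>f. (f x - f y)\<^sup>2 \<le> K * dirichlet_form X \<mu> p f"
  using assms(4)
proof induction
  case base
  show ?case by (intro exI[of _ 0]) simp
next
  case (step y z)
  then obtain K where K: "0 \<le> K" "\<And>f. (f x - f y)\<^sup>2 \<le> K * dirichlet_form X \<mu> p f" by auto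
  define c where "c = conductance \<mu> p y z"
  have yz: "y \<in> X" "z \<in> X" "0 < p y z" using step by auto
  then have c: "0 < c" using assms(3) by (auto simp: c_def conductance_def pmf_positive)
  \<comment> \<open>The constant comes from
    \<open>(r + s)\<^sup>2 \<le> 2 * r\<^sup>2 + 2 * s\<^sup>2\<close>, with \<open>K\<close>
    bounding the path so far and \<open>2 / c\<close> the new edge.\<close>
  have "(f x - f z)\<^sup>2 \<le> (2 * K + 4 / c) * dirichlet_form X \<mu> p f" for f
  proof -
    have "(f y - f z)\<^sup>2 \<le> 2 / c * dirichlet_form X \<mu> p f"
      using dirichlet_form_edge[OF assms(1) nonneg yz(1,2), where f = f and \<mu> = \<mu>] c
      by (simp add: c_def field_simps)
    moreover have "(f x - f z)\<^sup>2 \<le> 2 * (f x - f y)\<^sup>2 + 2 * (f y - f z)\<^sup>2"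
      using zero_le_power2[of "(f x - f y) - (f y - f z)"]
      by (simp add: power2_eq_square algebra_simps)
    ultimately show ?thesis using K(2)[of f] by (simp add: algebra_simps)
  qed
  then show ?case using K c by (intro exI[of _ "2 * K + 4 / c"]) simp
qed

text \<open>A purely qualitative bound, whose purpose is to exclude a zero spectral gap. The
  variance is at most the second moment about the value at a fixed point \<open>o'\<close>, and the
  path constants are averaged over \<open>\<mu>\<close>.\<close>

lemma poincare_inequality:
  assumes "finite X" and nonneg: "\<forall>x\<in>X. \<forall>y\<in>X. 0 \<le> p x y" and supp: "set_pmf \<mu> = X"
    and "irreducible_kernel X p"
  shows "\<exists>K>0. \<forall>f. measure_pmf.variance \<mu> f \<le> K * dirichlet_form X \<mu> p f"
proof -
  obtain o' where o': "o' \<in> X" using set_pmf_not_empty[of \<mu>] supp by auto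
  have "\<forall>x\<in>X. \<exists>K\<ge>0. \<forall>f. (f x - f o')\<^sup>2 \<le> K * dirichlet_form X \<mu> p f"
    using poincare_path[OF assms(1) nonneg, of \<mu>] supp assms(4) o'
    unfolding irreducible_kernel_def by blast
  then obtain K where K: "\<And>x. x \<in> X \<Longrightarrow> 0 \<le> K x"
    "\<And>x f. x \<in> X \<Longrightarrow> (f x - f o')\<^sup>2 \<le> K x * dirichlet_form X \<mu> p f" by metis
  define L where "L = (\<Sum>x\<in>X. pmf \<mu> x * K x)"
  have L: "0 \<le> L" unfolding L_def using K by (intro sum_nonneg) auto
  have one: "(\<Sum>x\<in>X. pmf \<mu> x) = 1" using sum_pmf_eq_1[OF assms(1)] supp by simp
  \<comment> \<open>The summand 1 only makes the constant strictly positive; \<open>L\<close> may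
    vanish.\<close>
  have "measure_pmf.variance \<mu> f \<le> (L + 1) * dirichlet_form X \<mu> p f" for f
  proof -
    let ?m = "\<Sum>x\<in>X. pmf \<mu> x * f x"
    have "(\<Sum>x\<in>X. pmf \<mu> x * (f x - f o')\<^sup>2)
        = (\<Sum>x\<in>X. pmf \<mu> x * (f x)\<^sup>2 - 2 * f o' * (pmf \<mu> x * f x) + (f o')\<^sup>2 * pmf \<mu> x)"
      by (intro sum.cong refl) (simp add: power2_eq_square algebra_simps)
    also have "\<dots> = (\<Sum>x\<in>X. pmf \<mu> x * (f x)\<^sup>2) - 2 * f o' * ?m + (f o')\<^sup>2"
      by (simp add: sum.distrib sum_subtractf one flip: sum_distrib_left)
    also have "\<dots> = measure_pmf.variance \<mu> f + (?m - f o')\<^sup>2"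
      using variance_pmf_finite[OF assms(1), of \<mu> f] supp by (simp add: power2_diff)
    finally have "measure_pmf.variance \<mu> f \<le> (\<Sum>x\<in>X. pmf \<mu> x * (f x - f o')\<^sup>2)"
      by simp
    also have "\<dots> \<le> (\<Sum>x\<in>X. pmf \<mu> x * (K x * dirichlet_form X \<mu> p f))"
      using K by (intro sum_mono mult_left_mono) auto
    also have "\<dots> = L * dirichlet_form X \<mu> p f"
      by (simp add: L_def sum_distrib_right mult.assoc)
    also have "\<dots> \<le> (L + 1) * dirichlet_form X \<mu> p f"
      using dirichlet_form_nonneg[OF nonneg, where f = f and \<mu> = \<mu>] by (simp add: algebra_simps)
    finally show ?thesis .
  qed
  then show ?thesis using L by (intro exI[of _ "L + 1"]) auto
qed

lemma inverse_spectral_gap_le: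
  assumes "0 < K" and "\<And>f. measure_pmf.variance \<mu> f \<le> K * dirichlet_form X \<mu> p f"
  shows "1 / spectral_gap X \<mu> p \<le> ereal K"
proof -
  have "ereal (1 / K) \<le> spectral_gap X \<mu> p"
    unfolding spectral_gap_def
  proof (rule INF_greatest)
    fix f :: "'a \<Rightarrow> real" assume "f \<in> {f. measure_pmf.variance \<mu> f \<noteq> 0}"
    then have "0 < measure_pmf.variance \<mu> f"
      by (simp add: less_le)
    then show "ereal (1 / K) \<le> ereal (dirichlet_form X \<mu> p f / measure_pmf.variance \<mu> f)"
      using assms(1) assms(2)[of f] by (simp add: field_simps)
  qed
  moreover have "1 / r \<le> K" if "1 / K \<le> r" for r
    using that assms(1) le_imp_inverse_le[of "1 / K" r] by (simp add: inverse_eq_divide)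
  ultimately show ?thesis using assms(1)
    by (cases "spectral_gap X \<mu> p") (auto simp: one_ereal_def)
qed

text \<open>Replaces the extended real \<open>1 / spectral_gap X \<mu> p\<close> by a real
  \<open>u\<close> that is itself a Poincare constant, so that the later arguments stay in the
  reals. An infinite gap corresponds to \<open>u = 0\<close>.\<close>

lemma obtain_inverse_spectral_gap:
  assumes "finite X" and nonneg: "\<forall>x\<in>X. \<forall>y\<in>X. 0 \<le> p x y" and supp: "set_pmf \<mu> = X"
    and "irreducible_kernel X p"
  obtains u where "0 \<le> u" "1 / spectral_gap X \<mu> p = ereal u"
    "\<And>f. measure_pmf.variance \<mu> f \<le> u * dirichlet_form X \<mu> p f"
proof -
  obtain K where K: "0 < K" "\<And>f. measure_pmf.variance \<mu> f \<le> K * dirichlet_form X \<mu> p f"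
    using poincare_inequality[OF assms] by blast
  have le: "1 / spectral_gap X \<mu> p \<le> ereal K" using inverse_spectral_gap_le[OF K] .
  have gap_le: "spectral_gap X \<mu> p \<le> ereal (dirichlet_form X \<mu> p f / measure_pmf.variance \<mu> f)"
    if "measure_pmf.variance \<mu> f \<noteq> 0" for f
    unfolding spectral_gap_def using that by (intro INF_lower) simp
  have gap_nonneg: "0 \<le> spectral_gap X \<mu> p"
    unfolding spectral_gap_def
    using dirichlet_form_nonneg[OF nonneg] measure_pmf.variance_positive[of \<mu>]
    by (intro INF_greatest) (simp add: zero_ereal_def)
  show ?thesis
  proof (cases "spectral_gap X \<mu> p")
    case (real r)
    \<comment> \<open>In \<open>ereal\<close>, \<open>1 / 0\<close> is infinite, which the finite
      bound \<open>le\<close> forbids.\<close>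
    have "r \<noteq> 0" using le real by (auto simp: one_ereal_def)
    then have r: "0 < r" using gap_nonneg real by simp
    have "measure_pmf.variance \<mu> f \<le> 1 / r * dirichlet_form X \<mu> p f" for f
    proof (cases "measure_pmf.variance \<mu> f = 0")
      case True
      then show ?thesis using dirichlet_form_nonneg[OF nonneg] r by simp
    next
      case False
      then have "0 < measure_pmf.variance \<mu> f"
        by (simp add: less_le)
      then show ?thesis using gap_le[OF False] real r by (simp add: field_simps)
    qed
    then show ?thesis using that[of "1 / r"] r real by (simp add: one_ereal_def)
  next
    case PInf
    then have "measure_pmf.variance \<mu> f = 0" for f :: "'a \<Rightarrow> real" using gap_le[of f] by auto
    then show ?thesis using that[of 0] PInf by (simp add: zero_ereal_def)
  next
    case MInf
    then show ?thesis using gap_nonneg by simp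
  qed
qed

section \<open>Conditioning on a nonempty subset, to be used for both \<open>R\<close> and
  \<open>X - R\<close>\<close>

context
  fixes X R :: "'a set" and \<mu> :: "'a pmf"
  assumes fin: "finite X" and supp: "set_pmf \<mu> = X" and sub: "R \<subseteq> X" and ne: "R \<noteq> {}"
begin

lemma prob_pos: "0 < measure_pmf.prob \<mu> R"
proof -
  obtain x where "x \<in> R" using ne by auto
  then show ?thesis using sub supp measure_pmf_posI[of x \<mu> R] by auto
qed

lemma cond_support: "set_pmf \<mu> \<inter> R \<noteq> {}"
  using sub supp ne by auto

lemma set_cond_pmf_eq: "set_pmf (cond_pmf \<mu> R) = R"
  using set_cond_pmf[OF cond_support] sub supp by auto

lemma pmf_cond_eq:
  "x \<in> R \<Longrightarrow> pmf (cond_pmf \<mu> R) x = pmf \<mu> x / measure_pmf.prob \<mu> R"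
  using pmf_cond[OF cond_support] by simp

text \<open>Second moment about \<open>t\<close> equals variance plus squared bias. The centre is
  left free: later uses take 0, 1 and the conditional means.\<close>

lemma sum_squares_cond:
  "(\<Sum>x\<in>R. pmf \<mu> x * (f x - t)\<^sup>2) = measure_pmf.prob \<mu> R *
    (measure_pmf.variance (cond_pmf \<mu> R) f
      + ((\<Sum>x\<in>R. pmf \<mu> x * f x) / measure_pmf.prob \<mu> R - t)\<^sup>2)"
proof -
  let ?a = "measure_pmf.prob \<mu> R" and ?S = "\<Sum>x\<in>R. pmf \<mu> x * f x"
  have finR: "finite R" using fin sub finite_subset by blast
  have "measure_pmf.variance (cond_pmf \<mu> R) f
      = (\<Sum>x\<in>R. pmf \<mu> x * (f x)\<^sup>2) / ?a - (?S / ?a)\<^sup>2"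
    using variance_pmf_finite[OF finR, of "cond_pmf \<mu> R" f] set_cond_pmf_eq
    by (simp add: pmf_cond_eq sum_divide_distrib)
  moreover have "(\<Sum>x\<in>R. pmf \<mu> x * (f x - t)\<^sup>2)
      = (\<Sum>x\<in>R. pmf \<mu> x * (f x)\<^sup>2 - 2 * t * (pmf \<mu> x * f x) + t\<^sup>2 * pmf \<mu> x)"
    by (intro sum.cong refl) (simp add: power2_eq_square algebra_simps)
  then have "(\<Sum>x\<in>R. pmf \<mu> x * (f x - t)\<^sup>2)
      = (\<Sum>x\<in>R. pmf \<mu> x * (f x)\<^sup>2) - 2 * t * ?S + t\<^sup>2 * ?a"
    by (simp add: sum.distrib sum_subtractf sum_pmf_eq_prob[OF finR] flip: sum_distrib_left)
  moreover have "Q - 2 * t * ?S + t\<^sup>2 * ?a = ?a * (Q / ?a - (?S / ?a)\<^sup>2 + (?S / ?a - t)\<^sup>2)" for Q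
    using prob_pos by (simp add: power2_eq_square field_simps)
  ultimately show ?thesis by simp
qed

text \<open>The restricted kernel differs from \<open>p\<close> only on the diagonal, where
  \<open>f x - f y\<close> vanishes; the prefactor cancels the normalisation of the conditional
  law.\<close>

lemma dirichlet_form_restricted:
  "measure_pmf.prob \<mu> R * dirichlet_form R (cond_pmf \<mu> R) (restricted_kernel X p R) f
    = dirichlet_form R \<mu> p f"
proof -
  have "measure_pmf.prob \<mu> R *
      (conductance (cond_pmf \<mu> R) (restricted_kernel X p R) x y * (f x - f y)\<^sup>2)
      = conductance \<mu> p x y * (f x - f y)\<^sup>2" if "x \<in> R" for x y
    using that prob_pos
    by (cases "x = y") (simp_all add: conductance_def restricted_kernel_def pmf_cond_eq)
  then have "measure_pmf.prob \<mu> R * (\<Sum>x\<in>R. \<Sum>y\<in>R.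
      conductance (cond_pmf \<mu> R) (restricted_kernel X p R) x y * (f x - f y)\<^sup>2)
      = (\<Sum>x\<in>R. \<Sum>y\<in>R. conductance \<mu> p x y * (f x - f y)\<^sup>2)"
    unfolding sum_distrib_left by (intro sum.cong refl)
  then show ?thesis by (simp add: dirichlet_form_def)
qed

lemma obtain_inverse_restricted_gap:
  assumes "\<forall>x\<in>X. \<forall>y\<in>X. 0 \<le> p x y"
    and "irreducible_kernel R (restricted_kernel X p R)"
  obtains u where "0 \<le> u" "1 / restricted_gap X \<mu> p R = ereal u"
    "\<And>f. measure_pmf.prob \<mu> R * measure_pmf.variance (cond_pmf \<mu> R) f
       \<le> u * dirichlet_form R \<mu> p f"
proof -
  have "\<forall>x\<in>R. \<forall>y\<in>R. 0 \<le> restricted_kernel X p R x y"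
    using assms(1) sub by (auto simp: restricted_kernel_def intro!: add_nonneg_nonneg sum_nonneg)
  then obtain u where u: "0 \<le> u" "1 / restricted_gap X \<mu> p R = ereal u"
    and le: "\<And>f. measure_pmf.variance (cond_pmf \<mu> R) f
       \<le> u * dirichlet_form R (cond_pmf \<mu> R) (restricted_kernel X p R) f"
    using obtain_inverse_spectral_gap[of R "restricted_kernel X p R" "cond_pmf \<mu> R"]
      set_cond_pmf_eq assms(2) finite_subset[OF sub fin] unfolding restricted_gap_def by metis
  have "measure_pmf.prob \<mu> R * measure_pmf.variance (cond_pmf \<mu> R) f
       \<le> u * dirichlet_form R \<mu> p f" for f
    using mult_left_mono[OF le, of "measure_pmf.prob \<mu> R" f] prob_pos
    by (simp add: mult.left_commute flip: dirichlet_form_restricted[of p f])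
  then show ?thesis using that u by blast
qed

end

section \<open>Decomposition along \<open>R\<close> and \<open>X - R\<close>\<close>

text \<open>The difference of the two sides is the energy of the edges between \<open>R\<close> and
  \<open>X - R\<close>, which is nonnegative.\<close>

lemma dirichlet_form_split:
  assumes "finite X" and nonneg: "\<forall>x\<in>X. \<forall>y\<in>X. 0 \<le> p x y" and "R \<subseteq> X"
  shows "dirichlet_form R \<mu> p f + dirichlet_form (X - R) \<mu> p f \<le> dirichlet_form X \<mu> p f"
proof -
  let ?g = "\<lambda>x y. conductance \<mu> p x y * (f x - f y)\<^sup>2"
  have le: "(\<Sum>x\<in>A. \<Sum>y\<in>A. ?g x y) \<le> (\<Sum>x\<in>A. \<Sum>y\<in>X. ?g x y)" if "A \<subseteq> X" for A
    using that conductance_nonneg[OF nonneg] assms(1) by (intro sum_mono sum_mono2) auto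
  have "(\<Sum>x\<in>X. \<Sum>y\<in>X. ?g x y) = (\<Sum>x\<in>R. \<Sum>y\<in>X. ?g x y) + (\<Sum>x\<in>X - R. \<Sum>y\<in>X. ?g x y)"
    using sum.subset_diff[OF assms(3,1)] by (simp add: add.commute)
  then show ?thesis using le[OF assms(3)] le[of "X - R"] by (simp add: dirichlet_form_def)
qed

text \<open>Law of total variance for the partition into \<open>R\<close> and
  \<open>X - R\<close>.\<close>

lemma variance_split:
  assumes fin: "finite X" and supp: "set_pmf \<mu> = X" and sub: "R \<subseteq> X" and ne: "R \<noteq> {}" "X - R \<noteq> {}"
  defines "a \<equiv> measure_pmf.prob \<mu> R" and "b \<equiv> measure_pmf.prob \<mu> (X - R)"
  shows "measure_pmf.variance \<mu> f = a * measure_pmf.variance (cond_pmf \<mu> R) f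
    + b * measure_pmf.variance (cond_pmf \<mu> (X - R)) f
    + a * b * ((\<Sum>x\<in>R. pmf \<mu> x * f x) / a - (\<Sum>x\<in>X - R. pmf \<mu> x * f x) / b)\<^sup>2"
proof -
  let ?S = "\<Sum>x\<in>R. pmf \<mu> x * f x" and ?T = "\<Sum>x\<in>X - R. pmf \<mu> x * f x"
  have split: "sum g X = sum g R + sum g (X - R)" for g :: "'a \<Rightarrow> real"
    using sum.subset_diff[OF sub fin] by (simp add: add.commute)
  have fins: "finite R" "finite (X - R)" using fin sub finite_subset by auto
  have pos: "0 < a" "0 < b"
    unfolding a_def b_def using prob_pos[OF fin supp] sub ne by auto
  have ab: "b = 1 - a"
    using split[of "pmf \<mu>"] sum_pmf_eq_1[OF fin, of \<mu>] supp fins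
    by (simp add: a_def b_def sum_pmf_eq_prob)
  have R: "(\<Sum>x\<in>R. pmf \<mu> x * (f x)\<^sup>2) = a * (measure_pmf.variance (cond_pmf \<mu> R) f + (?S / a)\<^sup>2)"
    using sum_squares_cond[OF fin supp sub ne(1), of f 0] by (simp add: a_def)
  have B: "(\<Sum>x\<in>X - R. pmf \<mu> x * (f x)\<^sup>2)
      = b * (measure_pmf.variance (cond_pmf \<mu> (X - R)) f + (?T / b)\<^sup>2)"
    using sum_squares_cond[OF fin supp Diff_subset ne(2), of f 0] by (simp add: b_def)
  have "a * (?S / a)\<^sup>2 + b * (?T / b)\<^sup>2 - (?S + ?T)\<^sup>2 = a * b * (?S / a - ?T / b)\<^sup>2"
  proof -
    \<comment> \<open>The variance of a two-point law with weights \<open>a\<close> and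
      \<open>1 - a\<close>.\<close>
    have "a * s\<^sup>2 + b * t\<^sup>2 - (a * s + b * t)\<^sup>2 = a * b * (s - t)\<^sup>2" for s t
      unfolding ab by (simp add: power2_eq_square algebra_simps)
    from this[of "?S / a" "?T / b"] show ?thesis using pos by simp
  qed
  then show ?thesis
    using variance_pmf_finite[OF fin, of \<mu> f] supp R B by (simp add: split algebra_simps)
qed

section \<open>Bounds on the soft capacities\<close>

text \<open>A real infimum bounds its members from below only if the set is bounded below; here all
  terms are nonnegative.\<close>

lemma soft_cap_le:
  assumes "\<forall>x\<in>X. \<forall>y\<in>X. 0 \<le> p x y" "0 \<le> \<kappa>" "0 \<le> l"
  shows "soft_cap X \<mu> p \<kappa> l A B \<le> dirichlet_form X \<mu> p f
    + \<kappa> * (\<Sum>a\<in>A. pmf \<mu> a * (f a - 1)\<^sup>2) + l * (\<Sum>b\<in>B. pmf \<mu> b * (f b)\<^sup>2)"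
  unfolding soft_cap_def
  using dirichlet_form_nonneg[OF assms(1)] assms
  by (intro cINF_lower bdd_belowI[of _ 0]) (auto intro!: add_nonneg_nonneg mult_nonneg_nonneg sum_nonneg)

text \<open>A function vanishing on \<open>B\<close> pays no \<open>l\<close> penalty, so the
  one-sided problem minimises the same functional over fewer functions.\<close>

lemma soft_cap_le_left:
  assumes "\<forall>x\<in>X. \<forall>y\<in>X. 0 \<le> p x y" "0 \<le> \<kappa>" "0 \<le> l"
  shows "soft_cap X \<mu> p \<kappa> l A B \<le> soft_cap_left X \<mu> p \<kappa> A B"
  unfolding soft_cap_left_def
proof (rule cINF_greatest)
  show "{f. \<forall>b\<in>B. f b = 0} \<noteq> {}" by (auto intro: exI[of _ "\<lambda>_. 0"])
  fix f :: "'a \<Rightarrow> real" assume "f \<in> {f. \<forall>b\<in>B. f b = 0}"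
  then show "soft_cap X \<mu> p \<kappa> l A B
      \<le> dirichlet_form X \<mu> p f + \<kappa> * (\<Sum>a\<in>A. pmf \<mu> a * (f a - 1)\<^sup>2)"
    using soft_cap_le[OF assms, of \<mu> A B f] by simp
qed

lemma soft_cap_le_right:
  assumes "\<forall>x\<in>X. \<forall>y\<in>X. 0 \<le> p x y" "0 \<le> \<kappa>" "0 \<le> l"
  shows "soft_cap X \<mu> p \<kappa> l A B \<le> soft_cap_right X \<mu> p l A B"
  unfolding soft_cap_right_def
proof (rule cINF_greatest)
  show "{f. \<forall>a\<in>A. f a = 1} \<noteq> {}" by (auto intro: exI[of _ "\<lambda>_. 1"])
  fix f :: "'a \<Rightarrow> real" assume "f \<in> {f. \<forall>a\<in>A. f a = 1}"
  then show "soft_cap X \<mu> p \<kappa> l A B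
      \<le> dirichlet_form X \<mu> p f + l * (\<Sum>b\<in>B. pmf \<mu> b * (f b)\<^sup>2)"
    using soft_cap_le[OF assms, of \<mu> A B f] by simp
qed

text \<open>The series law. For every \<open>f\<close> the elongations \<open>1 - m\<close>,
  \<open>m - n\<close> and \<open>n\<close> add up to 1; the outer two are paid for by the
  penalties, the middle one by the energy through the Poincare constant \<open>u\<close>.\<close>

lemma soft_cap_ge:
  assumes fin: "finite X" and nonneg: "\<forall>x\<in>X. \<forall>y\<in>X. 0 \<le> p x y"
    and supp: "set_pmf \<mu> = X" and sub: "R \<subseteq> X" and ne: "R \<noteq> {}" "X - R \<noteq> {}"
    and "0 < \<kappa>" "0 < l" "0 \<le> u"
    and poincare: "\<And>f. measure_pmf.variance \<mu> f \<le> u * dirichlet_form X \<mu> p f"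
  defines "a \<equiv> measure_pmf.prob \<mu> R" and "b \<equiv> measure_pmf.prob \<mu> (X - R)"
  shows "1 \<le> (1 / (\<kappa> * a) + u / (a * b) + 1 / (l * b)) * soft_cap X \<mu> p \<kappa> l R (X - R)"
proof -
  let ?s = "1 / (\<kappa> * a) + u / (a * b) + 1 / (l * b)"
  have pos: "0 < a" "0 < b"
    unfolding a_def b_def using prob_pos[OF fin supp] sub ne by auto
  \<comment> \<open>The outer compliances keep the sum positive even if
    \<open>u = 0\<close>.\<close>
  have s: "0 < ?s" using pos assms(7-9) by (intro add_pos_pos add_pos_nonneg) auto
  have "1 / ?s \<le> soft_cap X \<mu> p \<kappa> l R (X - R)"
    unfolding soft_cap_def
  proof (rule cINF_greatest)
    fix f :: "'a \<Rightarrow> real"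
    let ?F = "dirichlet_form X \<mu> p f + \<kappa> * (\<Sum>a\<in>R. pmf \<mu> a * (f a - 1)\<^sup>2)
      + l * (\<Sum>b\<in>X - R. pmf \<mu> b * (f b)\<^sup>2)"
    define m where "m = (\<Sum>x\<in>R. pmf \<mu> x * f x) / a"
    define n where "n = (\<Sum>x\<in>X - R. pmf \<mu> x * f x) / b"
    have vR: "0 \<le> measure_pmf.variance (cond_pmf \<mu> R) f"
      and vB: "0 \<le> measure_pmf.variance (cond_pmf \<mu> (X - R)) f"
      by (rule measure_pmf.variance_positive)+
    have "a * b * (m - n)\<^sup>2 \<le> measure_pmf.variance \<mu> f"
      using variance_split[OF fin supp sub ne, of f] vR vB pos by (simp add: m_def n_def a_def b_def)
    then have mid: "(m - n)\<^sup>2 \<le> u / (a * b) * dirichlet_form X \<mu> p f"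
      using poincare[of f] pos by (simp add: field_simps)
    have "a * (m - 1)\<^sup>2 \<le> (\<Sum>a\<in>R. pmf \<mu> a * (f a - 1)\<^sup>2)"
      using sum_squares_cond[OF fin supp sub ne(1), of f 1] vR pos
      by (simp add: m_def a_def algebra_simps)
    then have left: "(1 - m)\<^sup>2 \<le> 1 / (\<kappa> * a) * (\<kappa> * (\<Sum>a\<in>R. pmf \<mu> a * (f a - 1)\<^sup>2))"
      using pos assms(7) by (simp add: field_simps power2_commute)
    have "b * n\<^sup>2 \<le> (\<Sum>b\<in>X - R. pmf \<mu> b * (f b)\<^sup>2)"
      using sum_squares_cond[OF fin supp Diff_subset ne(2), of f 0] vB pos
      by (simp add: n_def b_def algebra_simps)
    then have right: "n\<^sup>2 \<le> 1 / (l * b) * (l * (\<Sum>b\<in>X - R. pmf \<mu> b * (f b)\<^sup>2))"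
      using pos assms(8) by (simp add: field_simps)
    have "((1 - m) + (m - n) + n)\<^sup>2 \<le> ?s * (\<kappa> * (\<Sum>a\<in>R. pmf \<mu> a * (f a - 1)\<^sup>2)
        + dirichlet_form X \<mu> p f + l * (\<Sum>b\<in>X - R. pmf \<mu> b * (f b)\<^sup>2))"
      using left mid right pos assms(7-9) dirichlet_form_nonneg[OF nonneg, where f = f and \<mu> = \<mu>]
      by (intro square_sum3_le_mult) (auto intro!: mult_nonneg_nonneg sum_nonneg)
    then have "1 \<le> ?s * ?F" by (simp add: algebra_simps)
    then show "1 / ?s \<le> ?F" using s by (simp add: pos_divide_le_eq mult.commute)
  qed simp
  then show ?thesis using s by (simp add: pos_divide_le_eq mult.commute)
qed

text \<open>The rescaled test function has conditional mean 1 on \<open>R\<close> and 0 on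
  \<open>X - R\<close>, so each penalty becomes a conditional variance. The multiplied form also
  covers equal means.\<close>

lemma soft_cap_mean_difference:
  assumes fin: "finite X" and nonneg: "\<forall>x\<in>X. \<forall>y\<in>X. 0 \<le> p x y"
    and supp: "set_pmf \<mu> = X" and sub: "R \<subseteq> X" and ne: "R \<noteq> {}" "X - R \<noteq> {}"
    and "0 < \<kappa>" "0 < l"
  defines "a \<equiv> measure_pmf.prob \<mu> R" and "b \<equiv> measure_pmf.prob \<mu> (X - R)"
  shows "soft_cap X \<mu> p \<kappa> l R (X - R)
      * ((\<Sum>x\<in>R. pmf \<mu> x * f x) / a - (\<Sum>x\<in>X - R. pmf \<mu> x * f x) / b)\<^sup>2
    \<le> dirichlet_form X \<mu> p f + \<kappa> * (a * measure_pmf.variance (cond_pmf \<mu> R) f)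
      + l * (b * measure_pmf.variance (cond_pmf \<mu> (X - R)) f)"
proof -
  define m where "m = (\<Sum>x\<in>R. pmf \<mu> x * f x) / a"
  define n where "n = (\<Sum>x\<in>X - R. pmf \<mu> x * f x) / b"
  let ?C = "soft_cap X \<mu> p \<kappa> l R (X - R)"
  let ?F = "dirichlet_form X \<mu> p f + \<kappa> * (a * measure_pmf.variance (cond_pmf \<mu> R) f)
      + l * (b * measure_pmf.variance (cond_pmf \<mu> (X - R)) f)"
  have "?C * (m - n)\<^sup>2 \<le> ?F"
  proof (cases "m = n")
    case True
    then show ?thesis
      using dirichlet_form_nonneg[OF nonneg, where f = f and \<mu> = \<mu>] assms(7,8)
        measure_pmf.variance_positive[of "cond_pmf \<mu> R" f]
        measure_pmf.variance_positive[of "cond_pmf \<mu> (X - R)" f]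
      by (simp add: a_def b_def)
  next
    case False
    let ?g = "\<lambda>x. (f x - n) / (m - n)"
    have "?g x - 1 = (f x - m) / (m - n)" for x using False by (simp add: field_simps)
    then have g: "pmf \<mu> x * (?g x - 1)\<^sup>2 = pmf \<mu> x * (f x - m)\<^sup>2 / (m - n)\<^sup>2"
      "pmf \<mu> x * (?g x)\<^sup>2 = pmf \<mu> x * (f x - n)\<^sup>2 / (m - n)\<^sup>2" for x
      by (simp_all add: power_divide)
    have "?C \<le> dirichlet_form X \<mu> p ?g + \<kappa> * (\<Sum>x\<in>R. pmf \<mu> x * (?g x - 1)\<^sup>2)
        + l * (\<Sum>x\<in>X - R. pmf \<mu> x * (?g x)\<^sup>2)"
      using assms(7,8) by (intro soft_cap_le nonneg) auto
    also have "\<dots> = (dirichlet_form X \<mu> p f + \<kappa> * (\<Sum>x\<in>R. pmf \<mu> x * (f x - m)\<^sup>2)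
        + l * (\<Sum>x\<in>X - R. pmf \<mu> x * (f x - n)\<^sup>2)) / (m - n)\<^sup>2"
      unfolding g dirichlet_form_affine by (simp add: add_divide_distrib flip: sum_divide_distrib)
    also have "\<dots> = ?F / (m - n)\<^sup>2"
      using sum_squares_cond[OF fin supp sub ne(1), of f m]
        sum_squares_cond[OF fin supp Diff_subset ne(2), of f n]
      by (simp add: m_def n_def a_def b_def)
    finally show ?thesis using False by (simp add: pos_le_divide_eq)
  qed
  then show ?thesis unfolding m_def n_def .
qed

section \<open>Relaxation time against the transition rate\<close>

theorem theorem2p10:
  fixes X R :: "'a set" and \<mu> :: "'a pmf" and p :: "'a \<Rightarrow> 'a \<Rightarrow> real" and \<kappa> l :: real
  assumes "finite X"
    and "markov_kernel X p"
    and "irreducible_kernel X p"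
    and "set_pmf \<mu> \<subseteq> X"
    and "reversible_kernel X \<mu> p"
    and "0 < \<kappa>" and "0 < l"
    and "R \<subseteq> X"
    and "irreducible_kernel R (restricted_kernel X p R)"
    and "irreducible_kernel (X - R) (restricted_kernel X p (X - R))"
  shows "(soft_cap_left X \<mu> p \<kappa> R (X - R) / (\<kappa> * measure_pmf.prob \<mu> R)
            + soft_cap_right X \<mu> p l R (X - R) / (l * measure_pmf.prob \<mu> (X - R)) \<le> 1 \<longrightarrow>
          1 / spectral_gap X \<mu> p \<ge>
           ereal (1 / transition_rate X \<mu> p \<kappa> l R *
             (1 - soft_cap_left X \<mu> p \<kappa> R (X - R) / (\<kappa> * measure_pmf.prob \<mu> R)
                - soft_cap_right X \<mu> p l R (X - R) / (l * measure_pmf.prob \<mu> (X - R)))\<^sup>2)) \<and>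
         1 / spectral_gap X \<mu> p \<le>
           ereal (1 / transition_rate X \<mu> p \<kappa> l R) *
             (1 + max (ereal (\<kappa> + transition_rate X \<mu> p \<kappa> l R) / restricted_gap X \<mu> p R)
                      (ereal (l + transition_rate X \<mu> p \<kappa> l R) / restricted_gap X \<mu> p (X - R)))"
proof -
  let ?C = "soft_cap X \<mu> p \<kappa> l R (X - R)"
  let ?\<phi> = "transition_rate X \<mu> p \<kappa> l R"
  let ?D = "dirichlet_form X \<mu> p"
  define a where "a = measure_pmf.prob \<mu> R"
  define b where "b = measure_pmf.prob \<mu> (X - R)"
  have nonneg: "\<forall>x\<in>X. \<forall>y\<in>X. 0 \<le> p x y"
    using assms(2) by (auto simp: markov_kernel_def)
  have supp: "set_pmf \<mu> = X" using set_pmf_eq_if_irreducible assms by blast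
  have ne: "R \<noteq> {}" "X - R \<noteq> {}" using assms(9,10) by (auto simp: irreducible_kernel_def)
  note setting = assms(1) supp assms(8) ne
  have pos: "0 < a" "0 < b"
    unfolding a_def b_def using prob_pos[OF assms(1) supp] assms(8) ne by auto
  obtain u where u: "0 \<le> u" "1 / spectral_gap X \<mu> p = ereal u"
    and uD: "\<And>f. measure_pmf.variance \<mu> f \<le> u * ?D f"
    using obtain_inverse_spectral_gap[OF assms(1) nonneg supp assms(3)] by blast
  obtain v where v: "0 \<le> v" "1 / restricted_gap X \<mu> p R = ereal v"
    and vD: "\<And>f. a * measure_pmf.variance (cond_pmf \<mu> R) f \<le> v * dirichlet_form R \<mu> p f"
    using obtain_inverse_restricted_gap[OF assms(1) supp assms(8) ne(1) nonneg assms(9)]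
    unfolding a_def by blast
  obtain w where w: "0 \<le> w" "1 / restricted_gap X \<mu> p (X - R) = ereal w"
    and wD: "\<And>f. b * measure_pmf.variance (cond_pmf \<mu> (X - R)) f
      \<le> w * dirichlet_form (X - R) \<mu> p f"
    using obtain_inverse_restricted_gap[OF assms(1) supp Diff_subset ne(2) nonneg assms(10)]
    unfolding b_def by blast
  have series: "1 \<le> (1 / (\<kappa> * a) + u / (a * b) + 1 / (l * b)) * ?C"
    unfolding a_def b_def
    using soft_cap_ge[OF assms(1) nonneg supp assms(8) ne assms(6,7) u(1) uD] .
  \<comment> \<open>Positivity is read off from \<open>series\<close>: a nonpositive capacity could
    not make the product reach 1.\<close>
  have "0 < ?C"
  proof (rule ccontr)
    assume "\<not> 0 < ?C"
    then have "(1 / (\<kappa> * a) + u / (a * b) + 1 / (l * b)) * ?C \<le> 0"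
      using pos u assms(6,7) by (intro mult_nonneg_nonpos) auto
    then show False using series by simp
  qed
  have \<phi>: "?\<phi> = ?C / (a * b)" by (simp add: transition_rate_def a_def b_def)
  then have \<phi>_pos: "0 < ?\<phi>" using \<open>0 < ?C\<close> pos by simp

  \<comment> \<open>The premise \<open>le1\<close> says that the bracket is nonnegative; this sign
    is used when the bracket is compared with its square.\<close>
  have lower: "1 / ?\<phi> * (1 - soft_cap_left X \<mu> p \<kappa> R (X - R) / (\<kappa> * a)
      - soft_cap_right X \<mu> p l R (X - R) / (l * b))\<^sup>2 \<le> u"
    if le1: "soft_cap_left X \<mu> p \<kappa> R (X - R) / (\<kappa> * a)
      + soft_cap_right X \<mu> p l R (X - R) / (l * b) \<le> 1"
  proof -
    define s where "s = soft_cap_left X \<mu> p \<kappa> R (X - R) / (\<kappa> * a)"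
    define t where "t = soft_cap_right X \<mu> p l R (X - R) / (l * b)"
    have s: "?C / (\<kappa> * a) \<le> s"
      unfolding s_def using soft_cap_le_left[OF nonneg] pos assms(6,7)
      by (intro divide_right_mono) auto
    have t: "?C / (l * b) \<le> t"
      unfolding t_def using soft_cap_le_right[OF nonneg] pos assms(6,7)
      by (intro divide_right_mono) auto
    have "0 \<le> s" "0 \<le> t"
      using s t \<open>0 < ?C\<close> pos assms(6,7) by (auto intro: order_trans[rotated])
    then have "(1 - s - t) * (1 - s - t) \<le> 1 * (1 - s - t)"
      using le1 by (intro mult_right_mono) (auto simp: s_def t_def)
    \<comment> \<open>Multiplied out, \<open>series\<close> reads
      \<open>1 \<le> ?C / (\<kappa> * a) + u * ?\<phi> + ?C / (l * b)\<close>, and \<open>s\<close>,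
      \<open>t\<close> dominate the outer terms.\<close>
    also have "\<dots> \<le> u * ?\<phi>" using series s t by (simp add: \<phi> algebra_simps)
    finally show ?thesis
      using \<phi>_pos by (simp add: power2_eq_square pos_divide_le_eq flip: s_def t_def)
  qed

  \<comment> \<open>The real value of the maximum in the upper bound, with \<open>v\<close> and
    \<open>w\<close> for the inverse restricted gaps.\<close>
  define K where "K = max ((\<kappa> + ?\<phi>) * v) ((l + ?\<phi>) * w)"
  have K: "0 \<le> K" using v \<phi>_pos assms(6) by (simp add: K_def le_max_iff_disj)
  have upper: "measure_pmf.variance \<mu> f \<le> 1 / ?\<phi> * (1 + K) * ?D f" for f
  proof -
    let ?V = "a * measure_pmf.variance (cond_pmf \<mu> R) f"
    let ?W = "b * measure_pmf.variance (cond_pmf \<mu> (X - R)) f"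
    let ?E = "dirichlet_form R \<mu> p f" and ?G = "dirichlet_form (X - R) \<mu> p f"
    define d where "d = (\<Sum>x\<in>R. pmf \<mu> x * f x) / a - (\<Sum>x\<in>X - R. pmf \<mu> x * f x) / b"
    have var: "measure_pmf.variance \<mu> f = ?V + ?W + a * b * d\<^sup>2"
      using variance_split[OF setting, of f] by (simp add: a_def b_def d_def)
    have "?C * d\<^sup>2 \<le> ?D f + \<kappa> * ?V + l * ?W"
      unfolding d_def a_def b_def
      using soft_cap_mean_difference[OF assms(1) nonneg supp assms(8) ne assms(6,7)] .
    moreover have "?C = ?\<phi> * (a * b)" using pos by (simp add: \<phi>)
    \<comment> \<open>Multiplying the variance decomposition by \<open>?\<phi>\<close> turns its
      last term into exactly \<open>?C * d\<^sup>2\<close>.\<close>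
    ultimately have "?\<phi> * measure_pmf.variance \<mu> f
        \<le> ?D f + (\<kappa> + ?\<phi>) * ?V + (l + ?\<phi>) * ?W"
      by (simp add: var algebra_simps)
    also have "\<dots> \<le> ?D f + (\<kappa> + ?\<phi>) * (v * ?E) + (l + ?\<phi>) * (w * ?G)"
      using vD[of f] wD[of f] \<phi>_pos assms(6,7) by (intro add_mono mult_left_mono) auto
    also have "\<dots> \<le> ?D f + K * ?E + K * ?G"
    proof -
      have "(\<kappa> + ?\<phi>) * v * ?E \<le> K * ?E" "(l + ?\<phi>) * w * ?G \<le> K * ?G"
        using nonneg assms(8)
        by (auto simp: K_def intro!: mult_right_mono dirichlet_form_nonneg)
      then show ?thesis by (simp add: mult.assoc)
    qed
    also have "\<dots> \<le> (1 + K) * ?D f"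
      using mult_left_mono[OF dirichlet_form_split[OF assms(1) nonneg assms(8)] K, of \<mu> f]
      by (simp add: algebra_simps)
    finally show ?thesis using \<phi>_pos by (simp add: pos_le_divide_eq mult.commute)
  qed
  have "1 / spectral_gap X \<mu> p \<le> ereal (1 / ?\<phi> * (1 + K))"
    using upper K \<phi>_pos by (intro inverse_spectral_gap_le) auto
  also have "ereal (1 / ?\<phi> * (1 + K)) = ereal (1 / ?\<phi>) *
      (1 + max (ereal (\<kappa> + ?\<phi>) / restricted_gap X \<mu> p R)
               (ereal (l + ?\<phi>) / restricted_gap X \<mu> p (X - R)))"
  proof -
    \<comment> \<open>Dividing through \<open>1 / g\<close> treats finite and infinite restricted
      gaps alike.\<close>
    have "ereal r / g = ereal (r * z)" if "1 / g = ereal z" for r z g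
      using that ereal_times_divide_eq[of "ereal r" 1 g] by simp
    from this[OF v(2)] this[OF w(2)] show ?thesis
      by (simp add: K_def one_ereal_def flip: ereal_max)
  qed
  finally show ?thesis using lower u(2) by (simp add: a_def b_def)
qed

end
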